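(* ($(p,q)$-Gauss sum.) Let $0<q<p$ and let $a,b,c,d,e,f$ be nonzero complex numbers with $ep^k\neq fq^k$ for all integers $k\ge 0$ and $$\left|\frac{acf}{bde}\right|<1.$$ Then $${}_2\Phi_1\big((a,b),(c,d);(e,f);(p,q),pf/(bd)\big)=\frac{((be,af),(de,cf);(p,q))_\infty}{((e,f),(bde,acf);(p,q))_\infty}.$$
   Context: For $n\ge 0$, $((a,b);(p,q))_n=\prod_{i=0}^{n-1}(ap^i-bq^i)$ (equal to $1$ for $n=0$), and $((a_1,b_1),\dots,(a_m,b_m);(p,q))_n=\prod_{j=1}^m((a_j,b_j);(p,q))_n$. The series ${}_2\Phi_1$ is $${}_2\Phi_1((a,b),(c,d);(e,f);(p,q),z)=\sum_{n=0}^\infty\frac{((a,b),(c,d);(p,q))_n}{((e,f);(p,q))_n\,((p,q);(p,q))_n}z^n.$$ A quotient of infinite products with the same number of pairs in numerator and denominator is understood as the limit as $N\to\infty$ of the same quotient with the subscript $\infty$ replaced by $N$. *)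

theory Defs
  imports Complex_Main
begin

definition pq_factorial1 :: "complex \<times> complex \<Rightarrow> complex \<times> complex \<Rightarrow> nat \<Rightarrow> complex" where
  "pq_factorial1 x pq n = (\<Prod>i<n. fst x * fst pq ^ i - snd x * snd pq ^ i)"

definition pq_factorial :: "(complex \<times> complex) list \<Rightarrow> complex \<times> complex \<Rightarrow> nat \<Rightarrow> complex" where
  "pq_factorial xs pq n = (\<Prod>x\<leftarrow>xs. pq_factorial1 x pq n)"

text \<open>
  Read only for lists of equal length. The quotient is the limit of the quotients of
  finite products: the infinite products in numerator and denominator
  need not converge separately.
\<close>

definition pq_infprod_quotient ::
  "(complex \<times> complex) list \<Rightarrow> (complex \<times> complex) list \<Rightarrow> complex \<times> complex \<Rightarrow> complex" where
  "pq_infprod_quotient xs ys pq = lim (\<lambda>N. pq_factorial xs pq N / pq_factorial ys pq N)"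

definition pq_Phi21_term ::
  "complex \<times> complex \<Rightarrow> complex \<times> complex \<Rightarrow> complex \<times> complex \<Rightarrow>
   complex \<times> complex \<Rightarrow> complex \<Rightarrow> nat \<Rightarrow> complex" where
  "pq_Phi21_term x y w pq z n =
     pq_factorial [x, y] pq n / (pq_factorial [w] pq n * pq_factorial [pq] pq n) * z ^ n"

definition pq_Phi21 ::
  "complex \<times> complex \<Rightarrow> complex \<times> complex \<Rightarrow> complex \<times> complex \<Rightarrow>
   complex \<times> complex \<Rightarrow> complex \<Rightarrow> complex" where
  "pq_Phi21 x y w pq z = (\<Sum>n. pq_Phi21_term x y w pq z n)"

end

theory Submission
  imports Defs "HOL-Analysis.Infinite_Products"
begin

text \<open>
  Put $r = q/p$, $A = b/a$, $B = d/c$, $C = f/e$. Pulling $a\,p^i$ out of every factor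
  $a p^i - b q^i$ turns each $(p,q)$-factorial into $a^n p^{n(n-1)/2}$ times an ordinary
  $q$-Pochhammer symbol $(A;r)_n$. The powers cancel in the quotient of products, and in the series
  they combine with $z$ to the argument $C/(AB)$. So the claim is Heine's $q$-Gauss sum
  $$F(C) := \sum_n \frac{(A;r)_n (B;r)_n}{(C;r)_n (r;r)_n} \Bigl(\frac{C}{AB}\Bigr)^n
     = \frac{(C/A;r)_\infty (C/B;r)_\infty}{(C;r)_\infty (C/(AB);r)_\infty}.$$

  The proof moves $C$ towards $0$ along $C, Cr, Cr^2, \ldots$. A termwise identity whose error
  telescopes (\<open>gauss_term_contiguous\<close>) gives
  $$F(C) = \frac{(1 - C/A)(1 - C/B)}{(1 - C)(1 - C/(AB))}\, F(Cr),$$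
  and $N$ applications give $F(C) = P_N\, F(C r^N)$, where $P_N$ is the quotient of the products
  cut off after $N$ factors (\<open>gauss_sum_iterate\<close>). The argument of the series
  $F(C r^N)$ is $r^N C/(AB)$, so in the limit only its constant term $1$ remains
  (\<open>gauss_sum_shift_tendsto_1\<close>). Hence $P_N \longrightarrow F(C)$, which is both the convergence
  of the quotient and its value.
\<close>

section \<open>The q-Pochhammer symbol\<close>

definition q_poch :: "complex \<Rightarrow> complex \<Rightarrow> nat \<Rightarrow> complex" where
  "q_poch x r n = (\<Prod>i<n. 1 - x * r ^ i)"

lemma q_poch_0 [simp]: "q_poch x r 0 = 1"
  by (simp add: q_poch_def)

lemma q_poch_Suc: "q_poch x r (Suc n) = q_poch x r n * (1 - x * r ^ n)"
  by (simp add: q_poch_def)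

lemma q_poch_add: "q_poch x r (m + n) = q_poch x r m * q_poch (x * r ^ m) r n"
  by (induction n) (simp_all add: q_poch_Suc power_add mult_ac)

lemma q_poch_nonzero:
  assumes "\<And>k. x * r ^ k \<noteq> 1"
  shows "q_poch x r n \<noteq> 0"
  using assms by (simp add: q_poch_def)

lemma mult_power_neq_1:
  fixes x r :: complex
  assumes "norm x < 1" "norm r < 1"
  shows "x * r ^ k \<noteq> 1"
proof
  assume "x * r ^ k = 1"
  then have "norm x * norm r ^ k = 1"
    by (metis norm_mult norm_one norm_power)
  moreover have "norm x * norm r ^ k \<le> norm x * 1"
    using assms by (intro mult_left_mono power_le_one) auto
  ultimately show False
    using assms by simp
qed

text \<open>
  That the limit is not $0$ is what makes the reciprocals $1/(x;r)_n$ bounded as well.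
\<close>

lemma q_poch_limit:
  assumes r: "norm r < 1" and x: "\<And>k. x * r ^ k \<noteq> 1"
  obtains L where "q_poch x r \<longlonglongrightarrow> L" "L \<noteq> 0"
proof -
  have "summable (\<lambda>i. norm x * norm r ^ i)"
    using r by (intro summable_mult summable_geometric) simp
  then have "abs_convergent_prod (\<lambda>i. 1 - x * r ^ i)"
    by (simp add: abs_convergent_prod_conv_summable norm_mult norm_power)
  then have cp: "convergent_prod (\<lambda>i. 1 - x * r ^ i)"
    by (rule abs_convergent_prod_imp_convergent_prod)
  have "(\<lambda>n. \<Prod>i\<le>n. 1 - x * r ^ i) \<longlonglongrightarrow> prodinf (\<lambda>i. 1 - x * r ^ i)"
    using cp by (rule convergent_prod_LIMSEQ)
  then have "(\<lambda>n. q_poch x r (Suc n)) \<longlonglongrightarrow> prodinf (\<lambda>i. 1 - x * r ^ i)"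
    by (simp add: q_poch_def lessThan_Suc_atMost del: prod.lessThan_Suc)
  then have "q_poch x r \<longlonglongrightarrow> prodinf (\<lambda>i. 1 - x * r ^ i)"
    by (simp only: filterlim_sequentially_Suc)
  moreover have "prodinf (\<lambda>i. 1 - x * r ^ i) \<noteq> 0"
    using cp x by (intro prodinf_nonzero) auto
  ultimately show ?thesis
    using that by blast
qed

text \<open>
  The bound is uniform in both $m$ and $n$ because
  $(x;r)_n / (x r^m;r)_n = (x;r)_n (x;r)_m / (x;r)_{m+n}$ involves a single sequence only, and that
  sequence is bounded and bounded away from $0$. This controls the denominators of all the
  series $F(C r^N)$ at once.
\<close>

lemma q_poch_shift_ratio_bounded:
  assumes r: "norm r < 1" and x: "\<And>k. x * r ^ k \<noteq> 1"
  obtains K where "\<And>m n. norm (q_poch x r n / q_poch (x * r ^ m) r n) \<le> K"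
proof -
  obtain L where L: "q_poch x r \<longlonglongrightarrow> L" "L \<noteq> 0"
    using q_poch_limit[OF r x] by blast
  have "Bseq (q_poch x r)"
    using L(1) by (intro convergent_imp_Bseq convergentI)
  then obtain U where U: "U > 0" "\<And>n. norm (q_poch x r n) \<le> U"
    by (auto elim: BseqE)
  have "Bseq (\<lambda>n. inverse (q_poch x r n))"
    using L by (intro convergent_imp_Bseq convergentI[OF tendsto_inverse])
  then obtain V where V: "V > 0" "\<And>n. norm (inverse (q_poch x r n)) \<le> V"
    by (auto elim: BseqE)
  have "norm (q_poch x r n / q_poch (x * r ^ m) r n) \<le> U * U * V" for m n
  proof -
    have "q_poch x r n / q_poch (x * r ^ m) r n
        = q_poch x r n * q_poch x r m * inverse (q_poch x r (m + n))"
      using q_poch_nonzero[OF x] by (simp add: q_poch_add field_simps)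
    then show ?thesis
      using U V by (auto simp: norm_mult intro!: mult_mono)
  qed
  then show ?thesis
    using that by blast
qed

section \<open>The terms of the q-Gauss series\<close>

text \<open>
  The argument $C/(AB)$ is built into the term, so that replacing $C$ by $Cr$ changes the
  argument along with the denominator parameter. The order of the parameters makes $C$ the one
  that varies in \<open>gauss_term A B r\<close>.
\<close>

definition gauss_term :: "complex \<Rightarrow> complex \<Rightarrow> complex \<Rightarrow> complex \<Rightarrow> nat \<Rightarrow> complex" where
  "gauss_term A B r C n =
     q_poch A r n * q_poch B r n / (q_poch C r n * q_poch r r n) * (C / (A * B)) ^ n"

lemma gauss_term_0 [simp]: "gauss_term A B r C 0 = 1"
  by (simp add: gauss_term_def)

lemma gauss_term_Suc:
  "gauss_term A B r C (Suc n) = gauss_term A B r C n *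
     ((1 - A * r ^ n) * (1 - B * r ^ n) / ((1 - C * r ^ n) * (1 - r ^ Suc n)) * (C / (A * B)))"
  by (simp add: gauss_term_def q_poch_Suc mult_ac)

lemma gauss_term_shift:
  assumes "\<And>k. C * r ^ k \<noteq> 1"
  shows "gauss_term A B r (C * r ^ N) n
       = gauss_term A B r C n * (q_poch C r n / q_poch (C * r ^ N) r n) * (r ^ N) ^ n"
  using q_poch_nonzero[OF assms]
  by (simp add: gauss_term_def power_mult_distrib power_divide mult_ac)

text \<open>
  The ratio of consecutive terms tends to $C/(AB)$. The ratio test is used as an
  inequality between consecutive terms, since the terms vanish from some point on
  when $A r^k = 1$ or $B r^k = 1$ for some $k$. A vanishing denominator likewise only produces
  zero terms, by the convention $x/0 = 0$.
\<close>

lemma gauss_term_summable_norm: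
  assumes r: "norm r < 1" and x: "norm (C / (A * B)) < 1"
  shows "summable (\<lambda>n. norm (gauss_term A B r C n))"
proof -
  define \<rho> where "\<rho> n = (1 - A * r ^ n) * (1 - B * r ^ n) /
    ((1 - C * r ^ n) * (1 - r ^ Suc n)) * (C / (A * B))" for n
  obtain c where c: "norm (C / (A * B)) < c" "c < 1"
    using dense[OF x] by blast
  have r0: "(\<lambda>n. r ^ n) \<longlonglongrightarrow> 0"
    using r by (rule LIMSEQ_power_zero)
  then have r1: "(\<lambda>n. r ^ Suc n) \<longlonglongrightarrow> 0"
    by (rule LIMSEQ_Suc)
  have "\<rho> \<longlonglongrightarrow> (1 - A * 0) * (1 - B * 0) / ((1 - C * 0) * (1 - 0)) * (C / (A * B))"
    unfolding \<rho>_def by (intro tendsto_intros r0 r1) simp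
  then have "(\<lambda>n. norm (\<rho> n)) \<longlonglongrightarrow> norm (C / (A * B))"
    by (intro tendsto_norm) simp
  then have "eventually (\<lambda>n. norm (\<rho> n) < c) sequentially"
    using c(1) by (rule order_tendstoD)
  then obtain M where M: "\<And>n. n \<ge> M \<Longrightarrow> norm (\<rho> n) < c"
    by (auto simp: eventually_sequentially)
  have "norm (gauss_term A B r C (Suc n)) \<le> c * norm (gauss_term A B r C n)" if "n \<ge> M" for n
    using mult_left_mono[OF less_imp_le[OF M[OF that]], of "norm (gauss_term A B r C n)"]
    unfolding gauss_term_Suc \<rho>_def[symmetric] norm_mult by (simp add: mult.commute)
  then show ?thesis
    using c(2) by (intro summable_ratio_test[of c M]) simp_all
qed

section \<open>The contiguous relation\<close>

text \<open>
  With $t_n$ the $n$-th term for $C$, $x = C/(AB)$ and $y = r^n$, the terms for $Cr$ and the next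
  term for $C$ are rational multiples of $t_n$:
  $$t_n(Cr) = \frac{(1-C)\,y}{1-Cy}\, t_n, \qquad
    (1 - ry)\, t_{n+1} = \frac{(1-Ay)(1-By)\,x}{1-Cy}\, t_n .$$
  The certificate $(1 - r^n)\, t_n$ comes from Gosper's method: the factor $1 - r^n$ cancels the new
  factor of $(r;r)_{n+1}$, and comparing the coefficients of $y^0$ fixes the constant in front of it.
  Without the common factor $t_n$, and multiplied by $1 - Cy$, the claim is a polynomial identity.
\<close>

lemma gauss_term_contiguous:
  assumes r: "norm r < 1" and AB: "A \<noteq> 0" "B \<noteq> 0" and C: "\<And>k. C * r ^ k \<noteq> 1"
  shows "(1 - C / (A * B)) * gauss_term A B r C n
       = (1 - C / A) * (1 - C / B) / (1 - C) * gauss_term A B r (C * r) n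
         + ((1 - r ^ n) * gauss_term A B r C n - (1 - r ^ Suc n) * gauss_term A B r C (Suc n))"
proof -
  define t where "t = gauss_term A B r C n"
  define y where "y = r ^ n"
  have C1: "1 - C \<noteq> 0"
    using C[of 0] by simp
  have Cy: "1 - C * y \<noteq> 0"
    using C[of n] by (simp add: y_def)
  have ry: "1 - r * y \<noteq> 0"
    using mult_power_neq_1[OF r r, of n] by (simp add: y_def)
  have "q_poch C r (1 + n) = (1 - C) * q_poch (C * r) r n"
    by (subst q_poch_add) (simp add: q_poch_Suc)
  then have "q_poch C r n * (1 - C * y) = (1 - C) * q_poch (C * r) r n"
    by (simp add: q_poch_Suc y_def)
  moreover have "q_poch (C * r) r n \<noteq> 0"
    by (rule q_poch_nonzero) (metis C mult.assoc power_Suc)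
  ultimately have "q_poch C r n / q_poch (C * r) r n = (1 - C) / (1 - C * y)"
    using Cy by (simp add: field_simps)
  then have shift: "gauss_term A B r (C * r) n = t * ((1 - C) / (1 - C * y)) * y"
    using gauss_term_shift[OF C, of A B 1 n] by (simp add: t_def y_def)
  have step: "(1 - r ^ Suc n) * gauss_term A B r C (Suc n)
      = t * ((1 - A * y) * (1 - B * y) / (1 - C * y) * (C / (A * B)))"
    using ry by (simp add: gauss_term_Suc t_def y_def)
  define x where "x = C / (A * B)"
  have x: "C / A = x * B" "C / B = x * A" "C = x * A * B"
    using AB by (simp_all add: x_def)
  define \<alpha> where "\<alpha> = (1 - C / A) * (1 - C / B)"
  define \<gamma> where "\<gamma> = (1 - A * y) * (1 - B * y) * x"
  define w where "w = 1 - C * y"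
  have w: "w \<noteq> 0"
    using Cy by (simp add: w_def)
  \<comment> \<open>Both sides are polynomials in \<open>A\<close>, \<open>B\<close>, \<open>x\<close> and \<open>y\<close>, because \<open>C = x * A * B\<close>.\<close>
  have "(1 - x) * w = \<alpha> * y + (1 - y) * w - \<gamma>"
    unfolding \<alpha>_def \<gamma>_def w_def x(1,2) by (subst (1 2) x(3)) (simp add: algebra_simps)
  also have "\<dots> = (\<alpha> * y / w + (1 - y) - \<gamma> / w) * w"
    using w by (simp add: distrib_right left_diff_distrib)
  finally have "1 - x = \<alpha> * y / w + (1 - y) - \<gamma> / w"
    using w by simp
  then have "(1 - x) * t = (\<alpha> * y / w + (1 - y) - \<gamma> / w) * t"
    by (rule arg_cong)
  also have "\<dots> = \<alpha> / (1 - C) * (t * ((1 - C) / w) * y) + ((1 - y) * t - t * (\<gamma> / w))"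
    unfolding distrib_right left_diff_distrib using C1 by (simp add: mult_ac)
  also have "\<alpha> / (1 - C) * (t * ((1 - C) / w) * y) = \<alpha> / (1 - C) * gauss_term A B r (C * r) n"
    by (simp only: shift w_def)
  also have "t * (\<gamma> / w) = (1 - r ^ Suc n) * gauss_term A B r C (Suc n)"
    by (simp only: step \<gamma>_def w_def x_def times_divide_eq_left
        times_divide_eq_right divide_divide_eq_left mult_ac)
  finally show ?thesis
    by (simp only: t_def y_def x_def \<alpha>_def)
qed

text \<open>
  The telescoping sum is $0$: the sequence $(1 - r^n)\, t_n$ starts with $1 - r^0 = 0$ and tends to
  $0$ because the terms do.
\<close>

lemma gauss_sum_contiguous:
  assumes r: "norm r < 1" and AB: "A \<noteq> 0" "B \<noteq> 0" and C: "\<And>k. C * r ^ k \<noteq> 1"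
    and x: "norm (C / (A * B)) < 1"
  shows "(\<Sum>n. gauss_term A B r C n)
       = (1 - C / A) * (1 - C / B) / ((1 - C) * (1 - C / (A * B))) *
         (\<Sum>n. gauss_term A B r (C * r) n)"
proof -
  define D where "D n = (1 - r ^ n) * gauss_term A B r C n" for n
  have "norm (C * r / (A * B)) \<le> norm (C / (A * B)) * 1"
    using r mult_left_mono[of "norm r" 1 "norm (C / (A * B))"]
    by (simp add: norm_mult norm_divide)
  then have x': "norm (C * r / (A * B)) < 1"
    using x by simp
  have S: "summable (gauss_term A B r C)" and S': "summable (gauss_term A B r (C * r))"
    using gauss_term_summable_norm[OF r x] gauss_term_summable_norm[OF r x']
    by (auto intro: summable_norm_cancel)
  have "D \<longlonglongrightarrow> (1 - 0) * 0"
    unfolding D_def using r summable_LIMSEQ_zero[OF S]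
    by (intro tendsto_intros LIMSEQ_power_zero)
  then have "(\<lambda>n. D n - D (Suc n)) sums (D 0 - 0)"
    by (intro telescope_sums') simp
  then have D: "(\<lambda>n. D n - D (Suc n)) sums 0"
    by (simp add: D_def)
  have "(\<lambda>n. (1 - C / A) * (1 - C / B) / (1 - C) * gauss_term A B r (C * r) n + (D n - D (Suc n)))
      sums ((1 - C / A) * (1 - C / B) / (1 - C) * (\<Sum>n. gauss_term A B r (C * r) n) + 0)"
    by (intro sums_add sums_mult summable_sums S' D)
  then have "(\<lambda>n. (1 - C / (A * B)) * gauss_term A B r C n)
      sums ((1 - C / A) * (1 - C / B) / (1 - C) * (\<Sum>n. gauss_term A B r (C * r) n))"
    using gauss_term_contiguous[OF r AB C] by (simp add: D_def)
  moreover have "(\<lambda>n. (1 - C / (A * B)) * gauss_term A B r C n)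
      sums ((1 - C / (A * B)) * (\<Sum>n. gauss_term A B r C n))"
    by (intro sums_mult summable_sums S)
  ultimately have "(1 - C / (A * B)) * (\<Sum>n. gauss_term A B r C n)
      = (1 - C / A) * (1 - C / B) / (1 - C) * (\<Sum>n. gauss_term A B r (C * r) n)"
    using sums_unique2 by blast
  moreover have "1 - C / (A * B) \<noteq> 0"
    using x by auto
  ultimately show ?thesis
    by (metis (no_types, lifting) divide_divide_eq_left nonzero_mult_div_cancel_left
        times_divide_eq_left)
qed

lemma gauss_sum_iterate:
  assumes r: "norm r < 1" and AB: "A \<noteq> 0" "B \<noteq> 0" and C: "\<And>k. C * r ^ k \<noteq> 1"
    and x: "norm (C / (A * B)) < 1"
  shows "(\<Sum>n. gauss_term A B r C n)
       = q_poch (C / A) r N * q_poch (C / B) r N / (q_poch C r N * q_poch (C / (A * B)) r N) *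
         (\<Sum>n. gauss_term A B r (C * r ^ N) n)"
proof (induction N)
  case (Suc N)
  have "C * r ^ N * r ^ k \<noteq> 1" for k
    using C[of "N + k"] by (simp add: power_add mult.assoc)
  moreover have "norm (C * r ^ N / (A * B)) < 1"
  proof -
    have "norm (C * r ^ N / (A * B)) = norm (C / (A * B)) * norm r ^ N"
      by (simp add: norm_mult norm_divide norm_power)
    also have "\<dots> \<le> norm (C / (A * B)) * 1"
      using r by (intro mult_left_mono power_le_one) auto
    finally show ?thesis using x by simp
  qed
  ultimately show ?case
    using Suc gauss_sum_contiguous[OF r AB, of "C * r ^ N"]
    by (simp add: q_poch_Suc mult_ac)
qed simp

section \<open>The q-Gauss sum\<close>

text \<open>
  Passing from $C$ to $C r^N$ multiplies the $n$-th term by $r^{Nn}$ and by a quotient of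
  $q$-Pochhammer symbols that is at most some $K$ in modulus. For $n \ge 1$ this gives
  $|t_n(C r^N)| \le K |r|^N |t_n(C)|$, so the tail is $O(|r|^N)$.
\<close>

lemma gauss_sum_shift_tendsto_1:
  assumes r: "norm r < 1" and C: "\<And>k. C * r ^ k \<noteq> 1" and x: "norm (C / (A * B)) < 1"
  shows "(\<lambda>N. \<Sum>n. gauss_term A B r (C * r ^ N) n) \<longlonglongrightarrow> 1"
proof -
  obtain K where K: "\<And>m n. norm (q_poch C r n / q_poch (C * r ^ m) r n) \<le> K"
    using q_poch_shift_ratio_bounded[OF r C] by blast
  have K0: "K \<ge> 0"
    by (rule order_trans[OF norm_ge_zero K])
  let ?t = "gauss_term A B r"
  define M where "M = (\<Sum>n. norm (?t C (Suc n)))"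
  have S: "summable (\<lambda>n. norm (?t C (Suc n)))"
    using gauss_term_summable_norm[OF r x] by (subst summable_Suc_iff)
  have "norm ((\<Sum>n. ?t (C * r ^ N) n) - 1) \<le> norm r ^ N * (K * M)" for N
  proof -
    have le: "norm (?t (C * r ^ N) (Suc n)) \<le> norm r ^ N * (K * norm (?t C (Suc n)))" for n
    proof -
      have "(norm r ^ N) ^ Suc n \<le> norm r ^ N"
        using r power_le_one[of "norm r" N] power_le_one[of "norm r ^ N" n]
        by (simp add: mult_left_le)
      then have "norm (?t C (Suc n)) * norm (q_poch C r (Suc n) / q_poch (C * r ^ N) r (Suc n))
            * (norm r ^ N) ^ Suc n \<le> norm (?t C (Suc n)) * K * norm r ^ N"
        using K K0 by (intro mult_mono) auto
      then show ?thesis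
        unfolding gauss_term_shift[OF C] norm_mult norm_power by (simp only: mult_ac)
    qed
    have SB: "summable (\<lambda>n. norm r ^ N * (K * norm (?t C (Suc n))))"
      by (intro summable_mult S)
    have SN: "summable (\<lambda>n. norm (?t (C * r ^ N) (Suc n)))"
      using le by (intro summable_comparison_test'[OF SB, of 0]) simp
    then have "summable (\<lambda>n. ?t (C * r ^ N) (Suc n))"
      by (rule summable_norm_cancel)
    then have "summable (?t (C * r ^ N))"
      by (subst (asm) summable_Suc_iff)
    then have "(\<Sum>n. ?t (C * r ^ N) n) - 1 = (\<Sum>n. ?t (C * r ^ N) (Suc n))"
      by (simp add: suminf_split_head)
    also have "norm \<dots> \<le> (\<Sum>n. norm (?t (C * r ^ N) (Suc n)))"
      using SN by (rule summable_norm)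
    also have "\<dots> \<le> (\<Sum>n. norm r ^ N * (K * norm (?t C (Suc n))))"
      using le SN SB by (rule suminf_le)
    also have "\<dots> = norm r ^ N * (K * M)"
      unfolding M_def by (simp only: suminf_mult[OF summable_mult[OF S]] suminf_mult[OF S])
    finally show ?thesis .
  qed
  moreover have "(\<lambda>N. norm r ^ N * (K * M)) \<longlonglongrightarrow> 0"
    using r by (intro tendsto_mult_left_zero LIMSEQ_power_zero) simp
  ultimately have "(\<lambda>N. (\<Sum>n. ?t (C * r ^ N) n) - 1) \<longlonglongrightarrow> 0"
    by (rule Lim_null_comparison[OF always_eventually[OF allI]])
  then show ?thesis
    by (simp add: LIM_zero_iff)
qed

text \<open>
  From $F(C) = P_N\, F(C r^N)$ with $F(C r^N) \longrightarrow 1$ one solves for $P_N$, so the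
  convergence of the quotient of products is a consequence. The argument covers $F(C) = 0$, which
  occurs when $C r^k = A$ or $C r^k = B$ for some $k$.
\<close>

lemma q_gauss_sum:
  assumes r: "norm r < 1" and AB: "A \<noteq> 0" "B \<noteq> 0" and C: "\<And>k. C * r ^ k \<noteq> 1"
    and x: "norm (C / (A * B)) < 1"
  shows "(\<lambda>N. q_poch (C / A) r N * q_poch (C / B) r N /
              (q_poch C r N * q_poch (C / (A * B)) r N)) \<longlonglongrightarrow> (\<Sum>n. gauss_term A B r C n)"
    (is "?P \<longlonglongrightarrow> ?S")
proof -
  let ?F = "\<lambda>N. \<Sum>n. gauss_term A B r (C * r ^ N) n"
  have F: "?F \<longlonglongrightarrow> 1"
    by (rule gauss_sum_shift_tendsto_1[OF r C x])
  then have "(\<lambda>N. ?S / ?F N) \<longlonglongrightarrow> ?S / 1"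
    by (intro tendsto_intros) simp_all
  moreover have "eventually (\<lambda>N. ?F N \<noteq> 0) sequentially"
    using F by (rule tendsto_imp_eventually_ne) simp
  then have "eventually (\<lambda>N. ?S / ?F N = ?P N) sequentially"
  proof eventually_elim
    case (elim N)
    then show ?case
      using gauss_sum_iterate[OF r AB C x, of N] by (metis nonzero_mult_div_cancel_right)
  qed
  ultimately show ?thesis
    by (simp add: Lim_transform_eventually)
qed

section \<open>From (p,q)-factorials to q-Pochhammer symbols\<close>

text \<open>
  The factor $\prod_{i<n} P^i$ does not depend on the pair, so it cancels from any quotient with
  equally many pairs above and below.
\<close>

lemma pq_factorial1_eq_q_poch:
  assumes "u \<noteq> 0" "P \<noteq> 0"
  shows "pq_factorial1 (u, v) (P, Q) n = u ^ n * (\<Prod>i<n. P ^ i) * q_poch (v / u) (Q / P) n"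
proof -
  have "u * P ^ i - v * Q ^ i = u * P ^ i * (1 - v / u * (Q / P) ^ i)" for i
    using assms by (simp add: field_simps)
  then show ?thesis
    by (simp add: pq_factorial1_def q_poch_def prod.distrib)
qed

theorem mainTheorem4:
  fixes p q :: real and a b c d e f :: complex
  defines "pq \<equiv> (complex_of_real p, complex_of_real q)"
  defines "z \<equiv> complex_of_real p * f / (b * d)"
  assumes "0 < q" and "q < p"
    and "a \<noteq> 0" and "b \<noteq> 0" and "c \<noteq> 0" and "d \<noteq> 0" and "e \<noteq> 0" and "f \<noteq> 0"
    and "\<forall>k::nat. e * complex_of_real p ^ k \<noteq> f * complex_of_real q ^ k"
    and "norm (a * c * f / (b * d * e)) < 1"
  shows "summable (pq_Phi21_term (a, b) (c, d) (e, f) pq z) \<and>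
    convergent (\<lambda>N. pq_factorial [(b * e, a * f), (d * e, c * f)] pq N /
                     pq_factorial [(e, f), (b * d * e, a * c * f)] pq N) \<and>
    pq_Phi21 (a, b) (c, d) (e, f) pq z =
      pq_infprod_quotient [(b * e, a * f), (d * e, c * f)] [(e, f), (b * d * e, a * c * f)] pq"
proof -
  define P Q where "P = complex_of_real p" and "Q = complex_of_real q"
  define r A B C where "r = Q / P" and "A = b / a" and "B = d / c" and "C = f / e"
  have P: "P \<noteq> 0"
    using assms(3,4) by (simp add: P_def)
  have nz: "a \<noteq> 0" "b \<noteq> 0" "c \<noteq> 0" "d \<noteq> 0" "e \<noteq> 0" "f \<noteq> 0"
    by fact+
  have AB: "A \<noteq> 0" "B \<noteq> 0"
    using nz by (simp_all add: A_def B_def)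
  have pq: "pq = (P, Q)"
    by (simp add: pq_def P_def Q_def)
  have r: "norm r < 1"
    using assms(3,4) by (simp add: r_def P_def Q_def norm_divide)
  have x_eq: "C / (A * B) = a * c * f / (b * d * e)"
    using nz by (simp add: A_def B_def C_def field_simps)
  then have x: "norm (C / (A * B)) < 1"
    using assms(12) by simp
  have C: "C * r ^ k \<noteq> 1" for k
  proof -
    have "f * Q ^ k \<noteq> e * P ^ k"
      using assms(11) by (metis P_def Q_def)
    then show ?thesis
      using nz P by (simp add: C_def r_def power_divide)
  qed
  have W: "(\<Prod>i<n. P ^ i) \<noteq> 0" for n
    using P by simp
  have "pq_Phi21_term (a, b) (c, d) (e, f) pq z n = gauss_term A B r C n" for n
  proof -
    define w where "w = (\<Prod>i<n. P ^ i)"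
    have "pq_Phi21_term (a, b) (c, d) (e, f) pq z n
        = (a ^ n * w * q_poch A r n * (c ^ n * w * q_poch B r n)) /
          (e ^ n * w * q_poch C r n * (P ^ n * w * q_poch r r n)) * z ^ n"
      using nz P by (simp add: pq_Phi21_term_def pq_factorial_def pq pq_factorial1_eq_q_poch
          A_def B_def C_def r_def w_def)
    also have "\<dots> = q_poch A r n * q_poch B r n / (q_poch C r n * q_poch r r n) *
        (a ^ n * c ^ n * z ^ n / (e ^ n * P ^ n))"
      using W[of n] by (simp add: w_def[symmetric] mult_ac)
    also have "a ^ n * c ^ n * z ^ n / (e ^ n * P ^ n) = (a * c * z / (e * P)) ^ n"
      by (simp add: power_mult_distrib power_divide)
    also have "a * c * z / (e * P) = C / (A * B)"
      using nz P by (simp add: x_eq z_def P_def mult_ac)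
    finally show ?thesis
      by (simp add: gauss_term_def)
  qed
  then have term_eq: "pq_Phi21_term (a, b) (c, d) (e, f) pq z = gauss_term A B r C"
    by blast
  have quot_eq: "pq_factorial [(b * e, a * f), (d * e, c * f)] pq N /
      pq_factorial [(e, f), (b * d * e, a * c * f)] pq N
      = q_poch (C / A) r N * q_poch (C / B) r N / (q_poch C r N * q_poch (C / (A * B)) r N)" for N
  proof -
    define w where "w = (\<Prod>i<N. P ^ i)"
    have F: "pq_factorial1 (u, v) pq N = u ^ N * w * q_poch (v / u) r N" if "u \<noteq> 0" for u v
      using pq_factorial1_eq_q_poch[OF that P] by (simp add: pq r_def w_def)
    have quots: "a * f / (b * e) = C / A" "c * f / (d * e) = C / B"
      using nz by (simp_all add: A_def B_def C_def mult_ac)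
    have "pq_factorial1 (b * e, a * f) pq N = (b * e) ^ N * w * q_poch (C / A) r N"
      "pq_factorial1 (d * e, c * f) pq N = (d * e) ^ N * w * q_poch (C / B) r N"
      "pq_factorial1 (e, f) pq N = e ^ N * w * q_poch C r N"
      "pq_factorial1 (b * d * e, a * c * f) pq N = (b * d * e) ^ N * w * q_poch (C / (A * B)) r N"
      using F[of "b * e" "a * f"] F[of "d * e" "c * f"] F[of e f] F[of "b * d * e" "a * c * f"] nz
      unfolding quots x_eq[symmetric] C_def[symmetric] by simp_all
    then have "pq_factorial [(b * e, a * f), (d * e, c * f)] pq N /
      pq_factorial [(e, f), (b * d * e, a * c * f)] pq N
      = ((b * e) ^ N * (d * e) ^ N * w ^ 2 * (q_poch (C / A) r N * q_poch (C / B) r N)) /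
        (e ^ N * (b * d * e) ^ N * w ^ 2 * (q_poch C r N * q_poch (C / (A * B)) r N))"
      by (simp only: pq_factorial_def list.map prod_list.Cons prod_list.Nil power2_eq_square mult_1_right)
        (simp only: mult_ac)
    also have "(b * e) ^ N * (d * e) ^ N = e ^ N * (b * d * e) ^ N"
      by (simp add: power_mult_distrib)
    finally show ?thesis
      using W[of N, folded w_def] nz by simp
  qed
  have lim: "(\<lambda>N. pq_factorial [(b * e, a * f), (d * e, c * f)] pq N /
      pq_factorial [(e, f), (b * d * e, a * c * f)] pq N) \<longlonglongrightarrow> (\<Sum>n. gauss_term A B r C n)"
    unfolding quot_eq by (rule q_gauss_sum[OF r AB C x])
  have "summable (gauss_term A B r C)"
    using gauss_term_summable_norm[OF r x] by (rule summable_norm_cancel)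
  then show ?thesis
    unfolding term_eq pq_Phi21_def pq_infprod_quotient_def
    using convergentI[OF lim] limI[OF lim] by simp
qed

end
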